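(* Fix $n\in\mathbb{N}$. For every partial function $f\colon\{0,1\}^n\to\{0,1\}$ there is a distribution $\mu$ on $\mathrm{Dom}(f)$ such that for all $\gamma\in(0,1]$, \[\mathrm{R}^\mu_{(1-\gamma)/2}(f)=\tilde{\Omega}\big(\gamma^2\,\mathrm{R}(f)\big),\] with universal constants.
   Context: A randomized Boolean circuit is a probability distribution over Boolean circuits (unbounded fan-in, unlimited depth); its size is the expected number of gates of a circuit drawn from it. $\mathrm{R}(f)$ is the minimum size of a randomized Boolean circuit computing $f$ with error at most $1/3$ on every $x\in\mathrm{Dom}(f)$. $\mathrm{R}^\mu_{(1-\gamma)/2}(f)$ is the minimum size of a randomized Boolean circuit with error probability at most $(1-\gamma)/2$ when the input is drawn from $\mu$. $\tilde{\Omega}$ hides factors polylogarithmic in $\mathrm{R}(f)$. *)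

theory Defs
  imports "HOL-Probability.Probability"
begin

text \<open>
  A circuit is a straight-line program: a nonempty list of gates in topological order, the last
  one being the output gate. A wire \<open>Gate_Wire j\<close> carries the value of the \<open>j\<close>-th gate of the
  list, so gates can be shared. Fan-in and depth are unbounded; \<open>And_Gate []\<close> and \<open>Or_Gate []\<close>
  are the constants.

  The size is the number of AND, OR and NOT gates; input variables are not gates. As the output
  is taken at a gate, every circuit has size at least 1. This convention matters: if bare input
  variables counted as circuits of size 0, a uniformly random variable would compute the majority
  of five bits with error at most \<open>2/5\<close> at no cost, while error at most \<open>1/3\<close> has positive cost,
  and no lower bound of the form \<open>c * \<gamma>\<^sup>2 * R(f)\<close> could hold.
\<close>

datatype wire = Input_Wire nat | Gate_Wire nat

datatype gate = Not_Gate wire | And_Gate "wire list" | Or_Gate "wire list"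

type_synonym circuit = "gate list"

fun gate_wires :: "gate \<Rightarrow> wire set" where
  "gate_wires (Not_Gate w) = {w}"
| "gate_wires (And_Gate ws) = set ws"
| "gate_wires (Or_Gate ws) = set ws"

definition boolean_circuit :: "nat \<Rightarrow> circuit \<Rightarrow> bool" where
  "boolean_circuit n C \<longleftrightarrow> C \<noteq> [] \<and>
     (\<forall>i<length C. \<forall>w\<in>gate_wires (C ! i).
        case w of Input_Wire j \<Rightarrow> j < n | Gate_Wire j \<Rightarrow> j < i)"

fun wire_value :: "bool list \<Rightarrow> bool list \<Rightarrow> wire \<Rightarrow> bool" where
  "wire_value x vs (Input_Wire j) = x ! j"
| "wire_value x vs (Gate_Wire j) = vs ! j"

fun gate_value :: "bool list \<Rightarrow> bool list \<Rightarrow> gate \<Rightarrow> bool" where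
  "gate_value x vs (Not_Gate w) = (\<not> wire_value x vs w)"
| "gate_value x vs (And_Gate ws) = (\<forall>w\<in>set ws. wire_value x vs w)"
| "gate_value x vs (Or_Gate ws) = (\<exists>w\<in>set ws. wire_value x vs w)"

definition gate_values :: "circuit \<Rightarrow> bool list \<Rightarrow> bool list" where
  "gate_values C x = foldl (\<lambda>vs g. vs @ [gate_value x vs g]) [] C"

definition circuit_output :: "circuit \<Rightarrow> bool list \<Rightarrow> bool" where
  "circuit_output C x = last (gate_values C x)"

definition circuit_size :: "circuit \<Rightarrow> nat" where
  "circuit_size C = length C"

definition randomized_circuit :: "nat \<Rightarrow> circuit pmf \<Rightarrow> bool" where
  "randomized_circuit n P \<longleftrightarrow> (\<forall>C\<in>set_pmf P. boolean_circuit n C)"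

definition randomized_size :: "circuit pmf \<Rightarrow> ennreal" where
  "randomized_size P = (\<integral>\<^sup>+ C. of_nat (circuit_size C) \<partial>measure_pmf P)"

text \<open>
  A partial function from \<open>{0,1}\<^sup>n\<close> to \<open>{0,1}\<close> is a map \<open>f\<close> with \<open>dom f \<subseteq> {x. length x = n}\<close>.
\<close>

definition R :: "nat \<Rightarrow> (bool list \<rightharpoonup> bool) \<Rightarrow> ennreal" where
  "R n f = Inf {randomized_size P | P. randomized_circuit n P \<and>
     (\<forall>x\<in>dom f. measure_pmf.prob P {C. f x \<noteq> Some (circuit_output C x)} \<le> 1 / 3)}"

text \<open>The error is over the independent choice of the circuit and of the input.\<close>

definition R_dist :: "nat \<Rightarrow> bool list pmf \<Rightarrow> real \<Rightarrow> (bool list \<rightharpoonup> bool) \<Rightarrow> ennreal" where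
  "R_dist n \<mu> \<epsilon> f = Inf {randomized_size P | P. randomized_circuit n P \<and>
     measure_pmf.prob (pair_pmf P \<mu>) {(C, x). f x \<noteq> Some (circuit_output C x)} \<le> \<epsilon>}"

end

theory Submission
  imports Defs
begin

text \<open>
  Write \<open>l(C)\<close> for the integer part of the base 4 logarithm of the size of a circuit \<open>C\<close>, and consider
  the game in which one player picks \<open>C\<close>, the other picks \<open>x \<in> Dom(f)\<close>, and the payoff is
  \<open>\<plusminus> 2\<^sup>-\<^sup>l\<close> according to whether \<open>C\<close> is correct on \<open>x\<close>. Since \<open>2\<^sup>l\<close> is about the square root of the
  size, a distribution \<open>\<mu>\<close> holding every circuit to payoff at most \<open>v\<close> forces size at least
  \<open>\<gamma>\<^sup>2 / v\<^sup>2\<close> for bias \<open>\<gamma>\<close>, for all \<open>\<gamma>\<close> simultaneously.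

  If there is no such \<open>\<mu>\<close>, a minimax argument yields a distribution on circuits whose payoff is of
  order \<open>v\<close> on every input. For each level \<open>l < a\<close>, sample \<open>4\<^sup>a\<^sup>-\<^sup>l\<close> circuits and let those of level
  exactly \<open>l\<close> vote with weight \<open>2\<^sup>l\<close>. With \<open>v\<close> of order \<open>a / 2\<^sup>a\<close>, Hoeffding's inequality shows that
  the weighted vote is correct with probability at least \<open>2/3\<close>. All levels cost the same,
  and the votes are added by ripple-carry adders, so that \<open>R(f)\<close> is at most of order
  \<open>a\<^sup>2 4\<^sup>a\<close>. It remains to choose \<open>a\<close> just too small for this bound on \<open>R(f)\<close>.
\<close>

section \<open>Composing circuits\<close>

fun valid_wire :: "nat \<Rightarrow> nat \<Rightarrow> wire \<Rightarrow> bool" where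
  "valid_wire n m (Input_Wire j) \<longleftrightarrow> j < n"
| "valid_wire n m (Gate_Wire j) \<longleftrightarrow> j < m"

text \<open>\<open>boolean_circuit\<close> without nonemptiness, so that constructions can start
  from the empty program.\<close>

definition straight_line :: "nat \<Rightarrow> circuit \<Rightarrow> bool" where
  "straight_line n C \<longleftrightarrow> (\<forall>i<length C. \<forall>w\<in>gate_wires (C ! i). valid_wire n i w)"

lemma boolean_circuit_iff: "boolean_circuit n C \<longleftrightarrow> C \<noteq> [] \<and> straight_line n C"
proof -
  have "(case w of Input_Wire j \<Rightarrow> j < n | Gate_Wire j \<Rightarrow> j < i) = valid_wire n i w" for w i
    by (cases w) auto
  then show ?thesis by (simp add: boolean_circuit_def straight_line_def)
qed

lemma straight_line_Nil [simp]: "straight_line n []"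
  by (simp add: straight_line_def)

lemma straight_line_snoc:
  "straight_line n (C @ [g]) \<longleftrightarrow> straight_line n C \<and> (\<forall>w\<in>gate_wires g. valid_wire n (length C) w)"
  by (auto simp: straight_line_def nth_append less_Suc_eq)

lemma gate_values_Nil [simp]: "gate_values [] x = []"
  by (simp add: gate_values_def)

lemma gate_values_snoc:
  "gate_values (C @ [g]) x = gate_values C x @ [gate_value x (gate_values C x) g]"
  by (simp add: gate_values_def)

lemma length_gate_values [simp]: "length (gate_values C x) = length C"
  by (induction C rule: rev_induct) (simp_all add: gate_values_snoc)

lemma wire_value_append:
  "valid_wire n (length vs) w \<Longrightarrow> wire_value x (vs @ us) w = wire_value x vs w"
  by (cases w) (auto simp: nth_append)

section \<open>Concatenation of programs with shifted gate indices\<close>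

fun shift_wire :: "nat \<Rightarrow> wire \<Rightarrow> wire" where
  "shift_wire m (Input_Wire j) = Input_Wire j"
| "shift_wire m (Gate_Wire j) = Gate_Wire (m + j)"

fun shift_gate :: "nat \<Rightarrow> gate \<Rightarrow> gate" where
  "shift_gate m (Not_Gate w) = Not_Gate (shift_wire m w)"
| "shift_gate m (And_Gate ws) = And_Gate (map (shift_wire m) ws)"
| "shift_gate m (Or_Gate ws) = Or_Gate (map (shift_wire m) ws)"

lemma wire_value_shift: "wire_value x (vs @ us) (shift_wire (length vs) w) = wire_value x us w"
  by (cases w) auto

lemma gate_value_shift: "gate_value x (vs @ us) (shift_gate (length vs) g) = gate_value x us g"
  by (cases g) (auto simp: wire_value_shift)

lemma gate_wires_shift: "gate_wires (shift_gate m g) = shift_wire m ` gate_wires g"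
  by (cases g) auto

lemma valid_wire_shift: "valid_wire n k w \<Longrightarrow> valid_wire n (m + k) (shift_wire m w)"
  by (cases w) auto

lemma gate_values_append_shift:
  "gate_values (C @ map (shift_gate (length C)) D) x = gate_values C x @ gate_values D x"
proof (induction D rule: rev_induct)
  case (snoc g D)
  have "gate_values (C @ map (shift_gate (length C)) (D @ [g])) x =
      gate_values ((C @ map (shift_gate (length C)) D) @ [shift_gate (length C) g]) x" by simp
  also have "\<dots> = (gate_values C x @ gate_values D x) @
      [gate_value x (gate_values C x @ gate_values D x) (shift_gate (length (gate_values C x)) g)]"
    by (simp only: gate_values_snoc snoc length_gate_values)
  also have "\<dots> = gate_values C x @ gate_values (D @ [g]) x"
    by (simp only: gate_value_shift gate_values_snoc append_assoc)
  finally show ?case .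
qed simp

lemma straight_line_append_shift:
  assumes "straight_line n C" "straight_line n D"
  shows "straight_line n (C @ map (shift_gate (length C)) D)"
  using assms(2)
proof (induction D rule: rev_induct)
  case (snoc g D)
  then have "straight_line n ((C @ map (shift_gate (length C)) D) @ [shift_gate (length C) g])"
    unfolding straight_line_snoc by (auto simp: gate_wires_shift intro: valid_wire_shift)
  then show ?case by simp
qed (use assms in simp)

text \<open>Tracking the set of functions carried by the wires of a program avoids any bookkeeping
  of wire indices.\<close>

definition computable :: "nat \<Rightarrow> (bool list \<Rightarrow> bool) set \<Rightarrow> nat \<Rightarrow> bool" where
  "computable n F s \<longleftrightarrow> (\<exists>C. straight_line n C \<and> length C \<le> s \<and>
     (\<forall>g\<in>F. \<exists>w. valid_wire n (length C) w \<and> (\<forall>x. wire_value x (gate_values C x) w = g x)))"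

section \<open>Closure properties of computable sets of functions\<close>

lemma computable_empty: "computable n {} 0"
  by (auto simp: computable_def intro: exI[of _ "[]"])

lemma computable_mono: "computable n F s \<Longrightarrow> F' \<subseteq> F \<Longrightarrow> s \<le> s' \<Longrightarrow> computable n F' s'"
  unfolding computable_def by (meson order_trans subsetD)

lemma computable_input:
  assumes "computable n F s" "j < n"
  shows "computable n (insert (\<lambda>x. x ! j) F) s"
proof -
  obtain C where C: "straight_line n C" "length C \<le> s"
    "\<And>g. g \<in> F \<Longrightarrow> \<exists>w. valid_wire n (length C) w \<and> (\<forall>x. wire_value x (gate_values C x) w = g x)"
    using assms(1) unfolding computable_def by blast
  show ?thesis
    unfolding computable_def
    by (rule exI[of _ C]) (use C assms(2) in \<open>auto intro: exI[of _ "Input_Wire j"]\<close>)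
qed

text \<open>Wires of the old program keep their indices and values when gates are appended, so
  nothing already available is lost.\<close>

lemma computable_append_circuit:
  assumes "computable n F s" "boolean_circuit n D"
  shows "computable n (insert (circuit_output D) F) (s + circuit_size D)"
proof -
  obtain C where C: "straight_line n C" "length C \<le> s"
    "\<And>g. g \<in> F \<Longrightarrow> \<exists>w. valid_wire n (length C) w \<and> (\<forall>x. wire_value x (gate_values C x) w = g x)"
    using assms(1) unfolding computable_def by blast
  let ?E = "C @ map (shift_gate (length C)) D"
  have D: "D \<noteq> []" "straight_line n D" using assms(2) by (auto simp: boolean_circuit_iff)
  have out: "wire_value x (gate_values ?E x) (Gate_Wire (length C + (length D - 1))) = circuit_output D x"
    for x
  proof -
    have "gate_values D x \<noteq> []" using D(1) by (metis length_0_conv length_gate_values)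
    then show ?thesis
      by (simp add: gate_values_append_shift nth_append circuit_output_def last_conv_nth)
  qed
  have old: "\<exists>w. valid_wire n (length ?E) w \<and> (\<forall>x. wire_value x (gate_values ?E x) w = g x)"
    if "g \<in> F" for g
  proof -
    obtain w where w: "valid_wire n (length C) w" "\<And>x. wire_value x (gate_values C x) w = g x"
      using C(3)[OF \<open>g \<in> F\<close>] by blast
    have "valid_wire n (length ?E) w" using w(1) by (cases w) auto
    moreover have "wire_value x (gate_values ?E x) w = g x" for x
      using w wire_value_append[of n "gate_values C x" w] by (simp add: gate_values_append_shift)
    ultimately show ?thesis by blast
  qed
  show ?thesis
    unfolding computable_def
  proof (rule exI[of _ ?E], intro conjI ballI)
    show "straight_line n ?E" by (rule straight_line_append_shift) (use C D in auto)
    show "length ?E \<le> s + circuit_size D" using C by (simp add: circuit_size_def)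
    show "\<exists>w. valid_wire n (length ?E) w \<and> (\<forall>x. wire_value x (gate_values ?E x) w = g x)"
      if "g \<in> insert (circuit_output D) F" for g
    proof (cases "g \<in> F")
      case False
      then have "g = circuit_output D" using that by simp
      then show ?thesis
        using out D(1) by (intro exI[of _ "Gate_Wire (length C + (length D - 1))"]) auto
    qed (rule old)
  qed
qed

text \<open>The program \<open>C\<close> is given explicitly instead of through
  \<open>computable\<close>, because the new gate \<open>G\<close> has to name wires of it. All
  connectives below are instances.\<close>

lemma computable_append_gate:
  assumes C: "straight_line n C" "length C \<le> s"
    "\<And>g. g \<in> F \<Longrightarrow> \<exists>w. valid_wire n (length C) w \<and> (\<forall>x. wire_value x (gate_values C x) w = g x)"
    and G: "\<And>w. w \<in> gate_wires G \<Longrightarrow> valid_wire n (length C) w"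
      "\<And>x. gate_value x (gate_values C x) G = h x"
  shows "computable n (insert h F) (Suc s)"
proof -
  let ?E = "C @ [G]"
  have old: "\<exists>w. valid_wire n (length ?E) w \<and> (\<forall>x. wire_value x (gate_values ?E x) w = g x)"
    if "g \<in> F" for g
  proof -
    obtain w where w: "valid_wire n (length C) w" "\<And>x. wire_value x (gate_values C x) w = g x"
      using C(3)[OF \<open>g \<in> F\<close>] by blast
    have "valid_wire n (length ?E) w" using w(1) by (cases w) auto
    moreover have "wire_value x (gate_values ?E x) w = g x" for x
      using w wire_value_append[of n "gate_values C x" w] by (simp add: gate_values_snoc)
    ultimately show ?thesis by blast
  qed
  have new: "\<exists>w. valid_wire n (length ?E) w \<and> (\<forall>x. wire_value x (gate_values ?E x) w = h x)"
    using G(2) by (intro exI[of _ "Gate_Wire (length C)"]) (auto simp: gate_values_snoc nth_append)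
  show ?thesis
    unfolding computable_def
    by (rule exI[of _ ?E]) (use C G old new in \<open>auto simp: straight_line_snoc\<close>)
qed

lemma computable_const:
  assumes "computable n F s"
  shows "computable n (insert (\<lambda>x. b) F) (Suc s)"
proof -
  obtain C where C: "straight_line n C" "length C \<le> s"
    "\<And>g. g \<in> F \<Longrightarrow> \<exists>w. valid_wire n (length C) w \<and> (\<forall>x. wire_value x (gate_values C x) w = g x)"
    using assms(1) unfolding computable_def by blast
  show ?thesis
    by (rule computable_append_gate[OF C, where G = "if b then And_Gate [] else Or_Gate []"])
      (auto split: if_splits)
qed

lemma computable_not:
  assumes "computable n F s" "g \<in> F"
  shows "computable n (insert (\<lambda>x. \<not> g x) F) (Suc s)"
proof -
  obtain C where C: "straight_line n C" "length C \<le> s"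
    "\<And>g. g \<in> F \<Longrightarrow> \<exists>w. valid_wire n (length C) w \<and> (\<forall>x. wire_value x (gate_values C x) w = g x)"
    using assms(1) unfolding computable_def by blast
  obtain w where "valid_wire n (length C) w" "\<And>x. wire_value x (gate_values C x) w = g x"
    using C(3)[OF assms(2)] by blast
  then show ?thesis
    by (intro computable_append_gate[OF C, where G = "Not_Gate w"]) auto
qed

lemma computable_and:
  assumes "computable n F s" "g \<in> F" "h \<in> F"
  shows "computable n (insert (\<lambda>x. g x \<and> h x) F) (Suc s)"
proof -
  obtain C where C: "straight_line n C" "length C \<le> s"
    "\<And>g. g \<in> F \<Longrightarrow> \<exists>w. valid_wire n (length C) w \<and> (\<forall>x. wire_value x (gate_values C x) w = g x)"
    using assms(1) unfolding computable_def by blast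
  obtain w where "valid_wire n (length C) w" "\<And>x. wire_value x (gate_values C x) w = g x"
    using C(3)[OF assms(2)] by blast
  moreover obtain u where "valid_wire n (length C) u" "\<And>x. wire_value x (gate_values C x) u = h x"
    using C(3)[OF assms(3)] by blast
  ultimately show ?thesis
    by (intro computable_append_gate[OF C, where G = "And_Gate [w, u]"]) auto
qed

lemma computable_or:
  assumes "computable n F s" "g \<in> F" "h \<in> F"
  shows "computable n (insert (\<lambda>x. g x \<or> h x) F) (Suc s)"
proof -
  obtain C where C: "straight_line n C" "length C \<le> s"
    "\<And>g. g \<in> F \<Longrightarrow> \<exists>w. valid_wire n (length C) w \<and> (\<forall>x. wire_value x (gate_values C x) w = g x)"
    using assms(1) unfolding computable_def by blast
  obtain w where "valid_wire n (length C) w" "\<And>x. wire_value x (gate_values C x) w = g x"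
    using C(3)[OF assms(2)] by blast
  moreover obtain u where "valid_wire n (length C) u" "\<And>x. wire_value x (gate_values C x) u = h x"
    using C(3)[OF assms(3)] by blast
  ultimately show ?thesis
    by (intro computable_append_gate[OF C, where G = "Or_Gate [w, u]"]) auto
qed

lemma computable_xor:
  assumes "computable n F s" "g \<in> F" "h \<in> F"
  shows "computable n (insert (\<lambda>x. g x \<noteq> h x) F) (s + 4)"
proof -
  note 1 = computable_and[OF assms]
  note 2 = computable_not[OF 1 insertI1]
  have 3: "computable n (insert (\<lambda>x. g x \<or> h x) (insert (\<lambda>x. \<not> (g x \<and> h x)) F)) (s + 3)"
    by (rule computable_mono[OF computable_or[OF 2, of g h]]) (use assms in auto)
  have eq: "(\<lambda>x. g x \<noteq> h x) = (\<lambda>x. (g x \<or> h x) \<and> \<not> (g x \<and> h x))" by auto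
  show ?thesis unfolding eq
    by (rule computable_mono[OF computable_and[OF 3,
          of "\<lambda>x. g x \<or> h x" "\<lambda>x. \<not> (g x \<and> h x)"]]) auto
qed

lemma computable_majority:
  assumes "computable n F s" "g \<in> F" "h \<in> F" "c \<in> F"
  shows "computable n (insert (\<lambda>x. g x \<and> h x \<or> c x \<and> (g x \<or> h x)) F) (s + 4)"
proof -
  note 1 = computable_and[OF assms(1-3)]
  have 2: "computable n (insert (\<lambda>x. g x \<or> h x) (insert (\<lambda>x. g x \<and> h x) F)) (s + 2)"
    by (rule computable_mono[OF computable_or[OF 1, of g h]]) (use assms in auto)
  have 3: "computable n (insert (\<lambda>x. c x \<and> (g x \<or> h x)) (insert (\<lambda>x. g x \<and> h x) F)) (s + 3)"
    by (rule computable_mono[OF computable_and[OF 2, of c "\<lambda>x. g x \<or> h x"]]) (use assms in auto)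
  show ?thesis
    by (rule computable_mono[OF computable_or[OF 3,
          of "\<lambda>x. g x \<and> h x" "\<lambda>x. c x \<and> (g x \<or> h x)"]]) auto
qed

lemma circuit_of_computable:
  assumes "computable n F s" "g \<in> F"
  shows "\<exists>D. boolean_circuit n D \<and> circuit_size D \<le> Suc s \<and> (\<forall>x. circuit_output D x = g x)"
proof -
  obtain C where C: "straight_line n C" "length C \<le> s"
    "\<And>g. g \<in> F \<Longrightarrow> \<exists>w. valid_wire n (length C) w \<and> (\<forall>x. wire_value x (gate_values C x) w = g x)"
    using assms(1) unfolding computable_def by blast
  obtain w where "valid_wire n (length C) w" "\<And>x. wire_value x (gate_values C x) w = g x"
    using C(3)[OF assms(2)] by blast
  then show ?thesis
    \<comment> \<open>A unary AND copies the wanted wire to the last gate, where the output is read.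
      The wire may be an input or lie in the middle of the program; this copy is the extra gate in
      \<open>Suc s\<close>.\<close>
    using C by (intro exI[of _ "C @ [And_Gate [w]]"])
      (auto simp: boolean_circuit_iff straight_line_snoc circuit_size_def circuit_output_def
        gate_values_snoc)
qed

section \<open>Weighted threshold circuits\<close>

text \<open>The carry into position \<open>i\<close>, not out of it. It is expressed as an overflow
  of the lower \<open>i\<close> bits, so the adder recursion becomes a lemma,
  \<open>carry_Suc\<close>.\<close>

definition carry :: "nat \<Rightarrow> nat \<Rightarrow> nat \<Rightarrow> bool" where
  "carry a b i \<longleftrightarrow> 2 ^ i \<le> a mod 2 ^ i + b mod 2 ^ i"

lemma carry_0 [simp]: "\<not> carry a b 0"
  by (simp add: carry_def)

text \<open>Division of \<open>a + b\<close> by \<open>2 ^ i\<close> yields the sum of both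
  quotients plus the carry, and bit \<open>i\<close> is the parity of that number.\<close>

lemma bit_add_carry: "bit (a + b :: nat) i \<longleftrightarrow> (bit a i \<noteq> (bit b i \<noteq> carry a b i))"
proof -
  have "(a mod 2 ^ i + b mod 2 ^ i) div 2 ^ i = (if carry a b i then 1 else 0)"
  proof (cases "carry a b i")
    case True
    have "a mod 2 ^ i < 2 ^ i" "b mod 2 ^ i < 2 ^ i" by auto
    then have "a mod 2 ^ i + b mod 2 ^ i - 2 ^ i < 2 ^ i" by linarith
    then show ?thesis using True by (simp add: carry_def le_div_geq)
  qed (simp add: carry_def)
  then have "(a + b) div 2 ^ i = a div 2 ^ i + b div 2 ^ i + (if carry a b i then 1 else 0)"
    by (simp add: div_add1_eq[of a b])
  then show ?thesis by (auto simp: bit_iff_odd)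
qed

text \<open>Split the top bit off both remainders modulo \<open>2 ^ Suc i\<close>: two top bits
  overflow by themselves, one does so exactly if the lower bits carry, and none never does.\<close>

lemma carry_Suc:
  "carry a b (Suc i) \<longleftrightarrow> bit a i \<and> bit b i \<or> carry a b i \<and> (bit a i \<or> bit b i)"
proof -
  have m: "c mod 2 ^ Suc i = 2 ^ i * (if bit c i then 1 else 0) + c mod 2 ^ i" for c :: nat
    by (simp only: power_Suc2 mod_mult2_eq) (auto simp: bit_iff_odd odd_iff_mod_2_eq_one)
  have "a mod 2 ^ i < 2 ^ i" "b mod 2 ^ i < 2 ^ i" by auto
  then have "\<not> 2 * 2 ^ i \<le> a mod 2 ^ i + b mod 2 ^ i" by linarith
  then show ?thesis unfolding carry_def m by auto
qed

text \<open>A ripple-carry adder. Each position costs 8 gates for two exclusive ors and 4 for the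
  majority that gives the next carry. The constant \<open>False\<close> is handed on because the
  next addition needs it again.\<close>

lemma computable_add:
  fixes N :: "bool list \<Rightarrow> nat"
  assumes "computable n F s" and N: "\<And>i. i \<le> L \<Longrightarrow> (\<lambda>x. bit (N x) i) \<in> F"
    and F: "v \<in> F" "(\<lambda>x. False) \<in> F"
  shows "computable n (insert (\<lambda>x. False) ((\<lambda>i x. bit (N x + (if v x then w else 0)) i) ` {..L}))
    (s + 12 * Suc L)"
proof -
  define W where "W x = (if v x then w else 0)" for x
  \<comment> \<open>As \<open>w\<close> is constant, each bit of the addend is either
    \<open>v\<close> itself or constantly false, so forming the addend costs no gates.\<close>
  have W: "(\<lambda>x. bit (W x) i) \<in> F" for i
  proof (cases "bit w i")
    case True
    then have "(\<lambda>x. bit (W x) i) = v" by (auto simp: W_def)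
    then show ?thesis using F by simp
  next
    case False
    then have "(\<lambda>x. bit (W x) i) = (\<lambda>x. False)" by (auto simp: W_def)
    then show ?thesis using F by simp
  qed
  let ?b = "\<lambda>i x. bit (N x + W x) i" and ?c = "\<lambda>i x. carry (N x) (W x) i"
  have "computable n (insert (?c i) (F \<union> ?b ` {..<i})) (s + 12 * i)" if "i \<le> Suc L" for i
    using that
  proof (induction i)
    case 0
    have "insert (?c 0) (F \<union> ?b ` {..<0}) = F" using F by auto
    then show ?case using assms(1) by simp
  next
    case (Suc i)
    let ?F = "insert (?c i) (F \<union> ?b ` {..<i})"
    let ?n = "\<lambda>x. bit (N x) i" and ?w = "\<lambda>x. bit (W x) i"
    have N': "?n \<in> F" using N Suc.prems by simp
    have IH: "computable n ?F (s + 12 * i)" using Suc by simp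
    note 1 = computable_xor[OF IH, of ?w "?c i"]
    have 2: "computable n (insert (\<lambda>x. ?n x \<noteq> (?w x \<noteq> ?c i x)) ?F) (s + 12 * i + 8)"
      by (rule computable_mono[OF computable_xor[OF 1, of ?n "\<lambda>x. ?w x \<noteq> ?c i x"]])
        (use N' W in auto)
    have 3: "computable n (insert (?c (Suc i)) (insert (?b i) ?F)) (s + 12 * i + 12)"
      unfolding carry_Suc bit_add_carry[of _ _ i]
      by (rule computable_mono[OF computable_majority[OF 2, of ?n ?w "?c i"]])
        (use N' W in auto)
    show ?case
      by (rule computable_mono[OF 3]) (auto simp: lessThan_Suc)
  qed
  from this[of "Suc L"] have "computable n (insert (?c (Suc L)) (F \<union> ?b ` {..<Suc L})) (s + 12 * Suc L)"
    by simp
  then show ?thesis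
    unfolding W_def lessThan_Suc_atMost by (rule computable_mono) (use F in auto)
qed

section \<open>Comparing a weighted sum of votes with a threshold\<close>

definition vote_sum :: "(circuit \<times> nat) list \<Rightarrow> bool list \<Rightarrow> nat" where
  "vote_sum cs x = (\<Sum>(D, w)\<leftarrow>cs. if circuit_output D x then w else 0)"

text \<open>Starting the accumulator at \<open>2 ^ L - \<theta>\<close> turns the comparison with \<open>\<theta>\<close> into reading off
  its bit \<open>L\<close>.\<close>

lemma threshold_circuit:
  assumes cs: "\<And>D w. (D, w) \<in> set cs \<Longrightarrow> boolean_circuit n D"
    and W: "(\<Sum>(D, w)\<leftarrow>cs. w) < 2 ^ L" and \<theta>: "\<theta> \<le> 2 ^ L" "\<theta> > 0"
  shows "\<exists>E. boolean_circuit n E \<and>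
    circuit_size E \<le> (\<Sum>(D, w)\<leftarrow>cs. circuit_size D) + length cs * (12 * Suc L) + 3 \<and>
    (\<forall>x. circuit_output E x \<longleftrightarrow> \<theta> \<le> vote_sum cs x)"
proof -
  let ?A = "\<lambda>cs x. 2 ^ L - \<theta> + vote_sum cs x"
  have "computable n (insert (\<lambda>x. False) ((\<lambda>i x. bit (?A cs x) i) ` {..L}))
      (2 + (\<Sum>(D, w)\<leftarrow>cs. circuit_size D) + length cs * (12 * Suc L))"
    using cs
  proof (induction cs)
    case Nil
    \<comment> \<open>Two gates supply both constants, hence all bits of the initial value. Together
      with the output gate from \<open>circuit_of_computable\<close> they account for the
      \<open>+ 3\<close>.\<close>
    have "computable n (insert (\<lambda>x. True) (insert (\<lambda>x. False) {})) 2"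
      using computable_const[OF computable_const[OF computable_empty[of n], of False], of True]
      by (simp add: numeral_2_eq_2)
    moreover have "(\<lambda>x::bool list. b) \<in> {\<lambda>x. True, \<lambda>x. False}" for b by (cases b) auto
    ultimately show ?case by (elim computable_mono) (auto simp: vote_sum_def)
  next
    case (Cons p cs)
    obtain D w where p: "p = (D, w)" by (cases p)
    have IH: "computable n (insert (\<lambda>x. False) ((\<lambda>i x. bit (?A cs x) i) ` {..L}))
      (2 + (\<Sum>(D, w)\<leftarrow>cs. circuit_size D) + length cs * (12 * Suc L))"
      by (rule Cons.IH) (use Cons.prems in auto)
    have D: "boolean_circuit n D" using Cons.prems p by auto
    have eq: "?A (p # cs) x = ?A cs x + (if circuit_output D x then w else 0)" for x
      by (simp add: vote_sum_def p)
    show ?case unfolding eq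
      by (rule computable_mono[OF computable_add[OF computable_append_circuit[OF IH D],
              of L "?A cs" "circuit_output D" w]]) (auto simp: p)
  qed
  then obtain E where E: "boolean_circuit n E"
    "circuit_size E \<le> Suc (2 + (\<Sum>(D, w)\<leftarrow>cs. circuit_size D) + length cs * (12 * Suc L))"
    "\<And>x. circuit_output E x = bit (?A cs x) L"
    using circuit_of_computable[of n _ _ "\<lambda>x. bit (?A cs x) L"] by blast
  have le: "vote_sum cs x \<le> (\<Sum>(D, w)\<leftarrow>cs. w)" for x
    unfolding vote_sum_def by (rule sum_list_mono) auto
  have "circuit_output E x \<longleftrightarrow> \<theta> \<le> vote_sum cs x" for x
  proof (cases "\<theta> \<le> vote_sum cs x")
    case True
    \<comment> \<open>The excess over \<open>\<theta>\<close> stays below \<open>2 ^ L\<close>, so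
      the accumulator cannot reach \<open>2 ^ (L + 1)\<close> and bit \<open>L\<close> remains
      set.\<close>
    have "?A cs x = 2 ^ L + (vote_sum cs x - \<theta>)" using True \<theta> by simp
    moreover have "vote_sum cs x - \<theta> < 2 ^ L" using le[of x] W by linarith
    ultimately have "?A cs x div 2 ^ L = 1" by simp
    then show ?thesis using True by (simp add: E bit_iff_odd)
  next
    case False
    then have "?A cs x < 2 ^ L" using \<theta> by linarith
    then have "?A cs x div 2 ^ L = 0" by simp
    then show ?thesis using False by (simp add: E bit_iff_odd)
  qed
  then show ?thesis using E by (intro exI[of _ E]) auto
qed

section \<open>A circuit for every partial function\<close>

lemma computable_indicator:
  "\<exists>s. computable n {\<lambda>x. \<forall>j<m. x ! j = y ! j} s" if "m \<le> n"
  using that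
proof (induction m)
  case 0
  then show ?case using computable_const[OF computable_empty, of n True] by auto
next
  case (Suc m)
  then obtain s where "computable n {\<lambda>x. \<forall>j<m. x ! j = y ! j} s" by auto
  then have 1: "computable n {\<lambda>x. x ! m, \<lambda>x. \<forall>j<m. x ! j = y ! j} s"
    using computable_input[of n _ s m] Suc.prems by simp
  have 2: "computable n (insert (\<lambda>x. \<not> x ! m) {\<lambda>x. x ! m, \<lambda>x. \<forall>j<m. x ! j = y ! j}) (Suc s)"
    by (rule computable_not[OF 1]) simp
  let ?l = "\<lambda>x. if y ! m then x ! m else \<not> x ! m"
  have "?l \<in> insert (\<lambda>x. \<not> x ! m) {\<lambda>x. x ! m, \<lambda>x. \<forall>j<m. x ! j = y ! j}"
    by (cases "y ! m") auto
  from computable_and[OF 2 this, of "\<lambda>x. \<forall>j<m. x ! j = y ! j"]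
  have "computable n {\<lambda>x. ?l x \<and> (\<forall>j<m. x ! j = y ! j)} (Suc (Suc s))"
    by (rule computable_mono) auto
  moreover have "(\<lambda>x. ?l x \<and> (\<forall>j<m. x ! j = y ! j)) = (\<lambda>x. \<forall>j<Suc m. x ! j = y ! j)"
    by (auto simp: less_Suc_eq fun_eq_iff)
  ultimately show ?case by auto
qed

lemma computable_membership:
  "finite Y \<Longrightarrow> \<exists>s. computable n {\<lambda>x. \<exists>y\<in>Y. \<forall>j<n. x ! j = y ! j} s"
proof (induction Y rule: finite_induct)
  case empty
  then show ?case using computable_const[OF computable_empty, of n False] by auto
next
  case (insert y Y)
  obtain s where s: "computable n {\<lambda>x. \<exists>y\<in>Y. \<forall>j<n. x ! j = y ! j} s" using insert by blast
  obtain t where "computable n {\<lambda>x. \<forall>j<n. x ! j = y ! j} t" using computable_indicator[of n n] by blast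
  from circuit_of_computable[OF this singletonI]
  obtain D where "boolean_circuit n D" "\<forall>x. circuit_output D x = (\<forall>j<n. x ! j = y ! j)"
    by (elim exE conjE)
  then have D: "boolean_circuit n D" "circuit_output D = (\<lambda>x. \<forall>j<n. x ! j = y ! j)"
    by (simp_all add: fun_eq_iff)
  have 1: "computable n (insert (circuit_output D) {\<lambda>x. \<exists>y\<in>Y. \<forall>j<n. x ! j = y ! j}) (s + circuit_size D)"
    by (rule computable_append_circuit[OF s D(1)])
  have 2: "computable n {\<lambda>x. circuit_output D x \<or> (\<exists>y\<in>Y. \<forall>j<n. x ! j = y ! j)} (Suc (s + circuit_size D))"
    by (rule computable_mono[OF computable_or[OF 1, of "circuit_output D" "\<lambda>x. \<exists>y\<in>Y. \<forall>j<n. x ! j = y ! j"]]) auto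
  then show ?case unfolding D(2) by auto
qed

lemma finite_bool_lists: "X \<subseteq> {x :: bool list. length x = n} \<Longrightarrow> finite X"
  using finite_lists_length_eq[of "UNIV :: bool set" n] by (auto intro: finite_subset)

text \<open>A disjunction of minterms over the finitely many inputs with value
  \<open>Some True\<close>. It serves only to show that \<open>R n f\<close> is finite, so its size
  is left open.\<close>

lemma circuit_for_partial_function:
  assumes "dom f \<subseteq> {x. length x = n}"
  shows "\<exists>D. boolean_circuit n D \<and> (\<forall>x\<in>dom f. f x = Some (circuit_output D x))"
proof -
  define Y where "Y = {x. f x = Some True}"
  have "Y \<subseteq> {x. length x = n}" using assms by (auto simp: Y_def)
  then have "finite Y" by (rule finite_bool_lists)
  from computable_membership[OF this, of n]
  obtain s where "computable n {\<lambda>x. \<exists>y\<in>Y. \<forall>j<n. x ! j = y ! j} s" ..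
  from circuit_of_computable[OF this singletonI]
  obtain D where D: "boolean_circuit n D"
    "\<forall>x. circuit_output D x \<longleftrightarrow> (\<exists>y\<in>Y. \<forall>j<n. x ! j = y ! j)"
    by (elim exE conjE)
  have "f x = Some (circuit_output D x)" if x: "x \<in> dom f" for x
  proof -
    have "x \<in> Y \<longleftrightarrow> circuit_output D x"
    proof
      assume "circuit_output D x"
      then obtain y where y: "y \<in> Y" "\<forall>j<n. x ! j = y ! j" using D(2) by blast
      moreover have "length y = n" "length x = n" using y(1) x assms by (auto simp: Y_def)
      ultimately have "x = y" by (intro nth_equalityI) auto
      then show "x \<in> Y" using y by simp
    qed (use D(2) in auto)
    then show ?thesis using x by (auto simp: Y_def dom_def)
  qed
  then show ?thesis using D by blast
qed

section \<open>Approximate minimax\<close>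

lemma exp_minus_le_quadratic:
  fixes y :: real
  assumes "\<bar>y\<bar> \<le> 1"
  shows "exp (- y) \<le> 1 - y + y\<^sup>2"
proof (cases "0 \<le> y")
  case True
  have "exp (- y) * (1 + y) \<le> exp (- y) * exp y"
    by (intro mult_left_mono) auto
  also have "\<dots> = 1" by (simp flip: exp_add)
  also have "\<dots> \<le> (1 - y + y\<^sup>2) * (1 + y)"
    using True by (simp add: algebra_simps power2_eq_square)
  finally show ?thesis using True by (simp add: mult_le_cancel_right)
next
  case False
  then show ?thesis using exp_bound[of "- y"] assms by simp
qed

text \<open>Multiplicative weights: answer the weights
  \<open>exp (- v / 2 * payoff so far)\<close> greedily; the total weight then decreases geometrically.\<close>

lemma approximate_minimax:
  fixes M :: "'i \<Rightarrow> 'x \<Rightarrow> real"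
  assumes X: "finite X" "X \<noteq> {}" and v: "v > 0"
    and bound: "\<And>i x. i \<in> I \<Longrightarrow> x \<in> X \<Longrightarrow> \<bar>M i x\<bar> \<le> 1"
    and response: "\<And>w. (\<And>x. x \<in> X \<Longrightarrow> w x > 0) \<Longrightarrow>
      \<exists>i\<in>I. v * sum w X \<le> (\<Sum>x\<in>X. w x * M i x)"
  shows "\<exists>q. finite (set_pmf q) \<and> set_pmf q \<subseteq> I \<and>
    (\<forall>x\<in>X. v / 4 \<le> measure_pmf.expectation q (\<lambda>i. M i x))"
proof -
  have card: "real (card X) > 0" using X by (simp add: card_gt_0_iff)
  \<comment> \<open>Constant weights show this: the average of entries bounded by 1 cannot exceed 1.
    It keeps \<open>\<eta>\<close> at most 1 and the factor \<open>1 - v\<^sup>2 / 4\<close>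
    nonnegative.\<close>
  have "v \<le> 1"
  proof -
    obtain i where i: "i \<in> I" "v * (\<Sum>x\<in>X. 1) \<le> (\<Sum>x\<in>X. 1 * M i x)"
      using response[of "\<lambda>_. 1"] by auto
    have "(\<Sum>x\<in>X. 1 * M i x) \<le> (\<Sum>x\<in>X. 1)"
      by (intro sum_mono) (use bound[OF i(1)] in \<open>force simp: abs_le_iff\<close>)
    then have "v * card X \<le> 1 * card X" using i(2) by simp
    then show ?thesis using card by (simp add: mult_le_cancel_right)
  qed
  \<comment> \<open>This step size minimizes \<open>1 + \<eta>\<^sup>2 - \<eta> * v\<close>, the
    factor by which the total weight shrinks in a round; the minimum is
    \<open>1 - v\<^sup>2 / 4\<close>.\<close>
  define \<eta> where "\<eta> = v / 2"
  have \<eta>: "\<eta> > 0" "\<eta> \<le> 1" using v \<open>v \<le> 1\<close> by (auto simp: \<eta>_def)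
  define w where "w cs x = exp (- \<eta> * (\<Sum>c\<leftarrow>cs. M c x))" for cs x
  have "\<exists>cs. length cs = T \<and> set cs \<subseteq> I \<and> sum (w cs) X \<le> card X * (1 - v\<^sup>2 / 4) ^ T" for T
  proof (induction T)
    case 0
    show ?case by (rule exI[of _ "[]"]) (simp add: w_def)
  next
    case (Suc T)
    then obtain cs where cs: "length cs = T" "set cs \<subseteq> I" "sum (w cs) X \<le> card X * (1 - v\<^sup>2 / 4) ^ T"
      by blast
    obtain i where i: "i \<in> I" "v * sum (w cs) X \<le> (\<Sum>x\<in>X. w cs x * M i x)"
      using response[of "w cs"] by (auto simp: w_def)
    have "w (i # cs) x \<le> w cs x * (1 - \<eta> * M i x + \<eta>\<^sup>2)" if "x \<in> X" for x
    proof -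
      have M: "\<bar>M i x\<bar> \<le> 1" using bound i that by auto
      have "\<bar>\<eta> * M i x\<bar> \<le> 1 * 1" unfolding abs_mult by (intro mult_mono) (use M \<eta> in auto)
      then have "exp (- (\<eta> * M i x)) \<le> 1 - \<eta> * M i x + (\<eta> * M i x)\<^sup>2"
        by (intro exp_minus_le_quadratic) simp
      also have "(\<eta> * M i x)\<^sup>2 \<le> \<eta>\<^sup>2"
        using M by (simp add: power_mult_distrib mult_left_le abs_square_le_1)
      finally have "exp (- (\<eta> * M i x)) \<le> 1 - \<eta> * M i x + \<eta>\<^sup>2" by simp
      moreover have "w (i # cs) x = w cs x * exp (- (\<eta> * M i x))"
        by (simp add: w_def algebra_simps flip: exp_add)
      ultimately show ?thesis by (simp add: w_def)
    qed
    then have "sum (w (i # cs)) X \<le> (\<Sum>x\<in>X. w cs x * (1 - \<eta> * M i x + \<eta>\<^sup>2))" by (rule sum_mono)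
    also have "\<dots> = (1 + \<eta>\<^sup>2) * sum (w cs) X - \<eta> * (\<Sum>x\<in>X. w cs x * M i x)"
      by (simp add: sum_distrib_left sum_distrib_right sum_subtractf sum.distrib algebra_simps)
    also have "\<dots> \<le> (1 + \<eta>\<^sup>2) * sum (w cs) X - \<eta> * (v * sum (w cs) X)"
      using i(2) \<eta> by simp
    also have "\<dots> = sum (w cs) X * (1 - v\<^sup>2 / 4)"
      by (simp add: \<eta>_def field_simps power2_eq_square)
    also have "\<dots> \<le> card X * (1 - v\<^sup>2 / 4) ^ T * (1 - v\<^sup>2 / 4)"
      using v \<open>v \<le> 1\<close> power_le_one[of v 2] by (intro mult_right_mono cs) auto
    finally show ?case using cs i by (intro exI[of _ "i # cs"]) (simp add: algebra_simps)
  qed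
  \<comment> \<open>Chosen so that \<open>ln (card X)\<close> is at most half of the total decrease
    \<open>v\<^sup>2 / 4 * T\<close> of the exponent. The \<open>Suc\<close> keeps \<open>T\<close>
    positive when \<open>X\<close> is a singleton.\<close>
  moreover define T where "T = Suc (nat \<lceil>8 * ln (card X) / v\<^sup>2\<rceil>)"
  ultimately obtain cs where cs: "length cs = T" "set cs \<subseteq> I"
    "sum (w cs) X \<le> card X * (1 - v\<^sup>2 / 4) ^ T" by blast
  have T: "8 * ln (card X) / v\<^sup>2 \<le> T" "T > 0" unfolding T_def by linarith+
  \<comment> \<open>A single weight is at most the total weight. Comparing exponents and dividing by
    \<open>\<eta>\<close> leaves \<open>v / 2 * T - v / 4 * T\<close>.\<close>
  have avg: "v / 4 * T \<le> (\<Sum>c\<leftarrow>cs. M c x)" if x: "x \<in> X" for x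
  proof -
    have "w cs x \<le> sum (w cs) X" by (rule member_le_sum) (use x X in \<open>auto simp: w_def\<close>)
    also note cs(3)
    also have "real (card X) * (1 - v\<^sup>2 / 4) ^ T \<le> card X * exp (- (v\<^sup>2 / 4)) ^ T"
      using v \<open>v \<le> 1\<close> power_le_one[of v 2] exp_ge_add_one_self[of "- (v\<^sup>2 / 4)"]
      by (intro mult_left_mono power_mono) auto
    also have "exp (- (v\<^sup>2 / 4)) ^ T = exp (- (v\<^sup>2 / 4 * T))"
      by (simp add: exp_of_nat_mult[symmetric] mult.commute)
    also have "card X * \<dots> = exp (ln (card X) - v\<^sup>2 / 4 * T)"
      using card by (simp only: exp_diff exp_minus exp_ln divide_inverse)
    finally have "- \<eta> * (\<Sum>c\<leftarrow>cs. M c x) \<le> ln (card X) - v\<^sup>2 / 4 * T" by (simp add: w_def)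
    moreover have "ln (card X) \<le> v\<^sup>2 / 8 * T" using T(1) v by (simp add: field_simps)
    ultimately have "v * (v / 4 * T) \<le> v * (\<Sum>c\<leftarrow>cs. M c x)"
      by (simp add: \<eta>_def field_simps power2_eq_square)
    then show ?thesis using v by (simp add: mult_le_cancel_left)
  qed
  \<comment> \<open>Uniform over the rounds, so that a strategy chosen repeatedly counts with its
    multiplicity.\<close>
  define q where "q = map_pmf (\<lambda>t. cs ! t) (pmf_of_set {..<T})"
  have ne: "{..<T} \<noteq> {}" using T(2) by auto
  have set_q: "set_pmf q = set cs" using cs(1) ne by (auto simp: q_def set_conv_nth)
  have "measure_pmf.expectation q (\<lambda>i. M i x) = (\<Sum>c\<leftarrow>cs. M c x) / T" for x
  proof -
    have "measure_pmf.expectation q (\<lambda>i. M i x) = (\<Sum>t<T. M (cs ! t) x) / T"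
      using ne by (simp add: q_def integral_pmf_of_set)
    also have "(\<Sum>t<T. M (cs ! t) x) = (\<Sum>c\<leftarrow>cs. M c x)"
      by (simp add: sum_list_sum_nth cs(1) atLeast0LessThan)
    finally show ?thesis .
  qed
  then have "v / 4 \<le> measure_pmf.expectation q (\<lambda>i. M i x)" if "x \<in> X" for x
    using avg[OF that] T(2) by (simp add: pos_le_divide_eq)
  then show ?thesis
    using cs(2) set_q by (intro exI[of _ q]) auto
qed

section \<open>Weighted voting among random circuits\<close>

text \<open>Meaningful for nonempty programs only; for size 0 no \<open>l\<close> qualifies and the
  value is unspecified.\<close>

definition level :: "circuit \<Rightarrow> nat" where
  "level C = (SOME l. 4 ^ l \<le> circuit_size C \<and> circuit_size C < 4 ^ (l + 1))"

lemma level_bounds: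
  assumes "boolean_circuit n C"
  shows "4 ^ level C \<le> circuit_size C" "circuit_size C < 4 ^ (level C + 1)"
proof -
  have "circuit_size C \<ge> 1"
    using assms by (simp add: boolean_circuit_def circuit_size_def Suc_le_eq)
  then have "\<exists>l. 4 ^ l \<le> circuit_size C \<and> circuit_size C < 4 ^ (l + 1)"
    by (intro ex_power_ivl1) auto
  then have "4 ^ level C \<le> circuit_size C \<and> circuit_size C < 4 ^ (level C + 1)"
    unfolding level_def by (rule someI_ex)
  then show "4 ^ level C \<le> circuit_size C" "circuit_size C < 4 ^ (level C + 1)" by auto
qed

definition agreement :: "(bool list \<rightharpoonup> bool) \<Rightarrow> circuit \<Rightarrow> bool list \<Rightarrow> real" where
  "agreement f C x = (if f x = Some (circuit_output C x) then 1 else - 1)"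

lemma abs_agreement [simp]: "\<bar>agreement f C x\<bar> = 1"
  by (simp add: agreement_def)

lemma R_le:
  assumes P: "randomized_circuit n P"
    and err: "\<And>x. x \<in> dom f \<Longrightarrow> measure_pmf.prob P {C. f x \<noteq> Some (circuit_output C x)} \<le> 1 / 3"
    and size: "\<And>C. C \<in> set_pmf P \<Longrightarrow> circuit_size C \<le> B"
  shows "R n f \<le> ennreal B"
proof -
  have "R n f \<le> randomized_size P"
    unfolding R_def by (rule Inf_lower) (use P err in blast)
  also have "\<dots> \<le> (\<integral>\<^sup>+ C. of_nat B \<partial>measure_pmf P)"
    unfolding randomized_size_def
    by (intro nn_integral_mono_AE AE_pmfI) (use size in \<open>simp\<close>)
  finally show ?thesis by (simp add: ennreal_of_nat_eq_real_of_nat)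
qed

text \<open>Level \<open>l\<close> gets \<open>4 ^ (a - l)\<close> random voters of weight \<open>2 ^ l\<close>, where a voter drawn from another
  level abstains. Every level then admits the same bounds on its total cost and variance.\<close>

definition voters :: "nat \<Rightarrow> (nat \<times> nat) set" where
  "voters a = (SIGMA l:{..<a}. {..<4 ^ (a - l)})"

lemma finite_voters [simp]: "finite (voters a)"
  by (simp add: voters_def)

lemma sum_voters: "(\<Sum>p\<in>voters a. h (fst p)) = (\<Sum>l<a. of_nat (4 ^ (a - l)) * h l)"
proof -
  have "(\<Sum>p\<in>voters a. h (fst p)) = (\<Sum>l<a. \<Sum>k<(4::nat) ^ (a - l). h l)"
    unfolding voters_def by (subst sum.Sigma) (auto intro!: sum.cong)
  then show ?thesis by simp
qed

lemma power4_split: "l < a \<Longrightarrow> (4::'a::comm_semiring_1) ^ a = 4 ^ (a - l) * 4 ^ l"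
  by (simp flip: power_add)

lemma power4_eq: "(4::'a::comm_semiring_1) ^ l = 2 ^ l * 2 ^ l"
proof -
  have "(4::'a) = 2 * 2" by simp
  then show ?thesis by (metis power_mult_distrib)
qed

text \<open>Hoeffding's inequality: the mean vote \<open>\<mu>\<close> is at least
  \<open>3 * a * 2 ^ a\<close>, while the squared ranges of the votes add up to
  \<open>4 * a * 4 ^ a\<close>, so the exponent is at most -2.\<close>

lemma voters_error:
  assumes a: "a \<ge> 1"
    and q: "finite (set_pmf q)"
    and adv: "4 * a / 2 ^ a \<le> measure_pmf.expectation q (\<lambda>C. agreement f C x / 2 ^ level C)"
  shows "measure_pmf.prob (Pi_pmf (voters a) d (\<lambda>_. q))
    {\<omega>. (\<Sum>p\<in>voters a. if level (\<omega> p) = fst p then 2 ^ fst p * agreement f (\<omega> p) x else 0) \<le> 0}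
      \<le> 1 / 3"
proof -
  let ?P = "Pi_pmf (voters a) d (\<lambda>_. q)"
  define h where "h l C = (if level C = l then 2 ^ l * agreement f C x else 0)" for l C
  define Y where "Y p \<omega> = h (fst p) (\<omega> p)" 
    for p :: "nat \<times> nat" and \<omega>
  define \<mu> where "\<mu> = (\<Sum>p\<in>voters a. measure_pmf.expectation ?P (Y p))"
  interpret Hoeffding_ineq "measure_pmf ?P" "voters a" Y "\<lambda>p. - (2 ^ fst p)" "\<lambda>p. 2 ^ fst p" \<mu>
  proof unfold_locales
    show "prob_space.indep_vars (measure_pmf ?P) (\<lambda>_. borel) Y (voters a)"
      unfolding Y_def
      by (rule prob_space.indep_vars_compose2[OF _ indep_vars_Pi_pmf])
        (auto simp: measure_pmf.prob_space_axioms)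
    show "AE \<omega> in measure_pmf ?P. Y p \<omega> \<in> {- (2 ^ fst p)..2 ^ fst p}" for p
      by (auto simp: Y_def h_def agreement_def)
  qed (simp_all add: \<mu>_def)
  have E: "measure_pmf.expectation ?P (Y p) = measure_pmf.expectation q (h (fst p))" if "p \<in> voters a" for p
  proof -
    have "measure_pmf.expectation ?P (Y p) = measure_pmf.expectation (map_pmf (\<lambda>\<omega>. \<omega> p) ?P) (h (fst p))"
      by (simp add: Y_def[abs_def])
    then show ?thesis using that by (simp add: Pi_pmf_component)
  qed
  have int: "integrable (measure_pmf q) g" for g :: "circuit \<Rightarrow> real"
    by (rule integrable_measure_pmf_finite[OF q])
  \<comment> \<open>A circuit of level below \<open>a\<close> contributes exactly its scaled payoff.
    One of level at least \<open>a\<close> always abstains, and its payoff is at most the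
    \<open>1 / 2 ^ a\<close> subtracted here.\<close>
  have pt: "4 ^ a * (agreement f C x / 2 ^ level C - 1 / 2 ^ a) \<le> (\<Sum>l<a. 4 ^ (a - l) * h l C)" for C
  proof (cases "level C < a")
    case True
    have "(\<Sum>l<a. 4 ^ (a - l) * h l C) =
        (\<Sum>l<a. if l = level C then 4 ^ (a - level C) * (2 ^ level C * agreement f C x) else 0)"
      by (rule sum.cong) (auto simp: h_def)
    also have "\<dots> = 4 ^ (a - level C) * (2 ^ level C * agreement f C x)" using True by simp
    also have "\<dots> = 4 ^ a * (agreement f C x / 2 ^ level C)"
      by (simp add: power4_split[OF True, where 'a = real] power4_eq[of "level C"])
    finally show ?thesis by (simp add: algebra_simps)
  next
    case False
    then have "(\<Sum>l<a. 4 ^ (a - l) * h l C) = 0" by (intro sum.neutral) (auto simp: h_def)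
    moreover have "agreement f C x / 2 ^ level C \<le> 1 / 2 ^ a"
      using False by (intro frac_le) (auto simp: agreement_def)
    ultimately show ?thesis by (simp add: mult_le_0_iff)
  qed
  \<comment> \<open>Of the advantage \<open>4 * a / 2 ^ a\<close>, at most a quarter pays for
    ignoring the levels from \<open>a\<close> on.\<close>
  have "3 * real a * 2 ^ a \<le> 4 ^ a * (4 * a / 2 ^ a - 1 / 2 ^ a)"
    using a by (simp add: power4_eq field_simps)
  also have "\<dots> \<le> 4 ^ a * (measure_pmf.expectation q (\<lambda>C. agreement f C x / 2 ^ level C) - 1 / 2 ^ a)"
    using adv by (intro mult_left_mono) auto
  also have "\<dots> = measure_pmf.expectation q (\<lambda>C. 4 ^ a * (agreement f C x / 2 ^ level C - 1 / 2 ^ a))"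
    by (simp add: int)
  also have "\<dots> \<le> measure_pmf.expectation q (\<lambda>C. \<Sum>l<a. 4 ^ (a - l) * h l C)"
    by (intro integral_mono int pt)
  also have "\<dots> = (\<Sum>l<a. 4 ^ (a - l) * measure_pmf.expectation q (h l))"
    by (simp add: int)
  also have "\<dots> = \<mu>"
    using sum_voters[of "\<lambda>l. measure_pmf.expectation q (h l)" a] E by (simp add: \<mu>_def)
  finally have \<mu>: "3 * real a * 2 ^ a \<le> \<mu>" .
  have var: "(\<Sum>p\<in>voters a. (2 ^ fst p - - (2 ^ fst p))\<^sup>2) = (4 * a * 4 ^ a :: real)"
  proof -
    have "(\<Sum>p\<in>voters a. (2 ^ fst p - - (2 ^ fst p))\<^sup>2 :: real) =
        (\<Sum>l<a. of_nat (4 ^ (a - l)) * (2 ^ l - - (2 ^ l))\<^sup>2)"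
      by (rule sum_voters)
    also have "\<dots> = (\<Sum>l<a. 4 * 4 ^ a)"
    proof (rule sum.cong)
      fix l assume "l \<in> {..<a}"
      moreover have "(2 ^ l - - (2 ^ l))\<^sup>2 = (4 * 4 ^ l :: real)"
        by (simp add: power2_eq_square power4_eq)
      ultimately show "of_nat (4 ^ (a - l)) * (2 ^ l - - (2 ^ l))\<^sup>2 = (4 * 4 ^ a :: real)"
        by (simp add: power4_split[of l a])
    qed simp
    finally show ?thesis by simp
  qed
  have "measure_pmf.prob ?P {\<omega>. (\<Sum>p\<in>voters a. Y p \<omega>) \<le> 0} \<le> exp (- 2 * \<mu>\<^sup>2 / (4 * a * 4 ^ a))"
  proof -
    have "0 \<le> \<mu>" by (rule order_trans[OF _ \<mu>]) simp
    \<comment> \<open>The deviation is taken equal to the mean, so the event is that the sum is at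
      most 0.\<close>
    then show ?thesis using Hoeffding_ineq_le[of \<mu>, unfolded var] a by simp
  qed
  also have "\<dots> \<le> exp (- 2)"
  proof -
    have "(3 * real a * 2 ^ a)\<^sup>2 \<le> \<mu>\<^sup>2" using \<mu> by (intro power_mono) auto
    moreover have "4 * real a * 4 ^ a \<le> (3 * real a * 2 ^ a)\<^sup>2"
    proof -
      have "4 * real a \<le> 9 * (real a)\<^sup>2"
        using mult_right_mono[of 1 "real a" "real a"] a by (simp add: power2_eq_square)
      then have "4 * real a * 4 ^ a \<le> 9 * (real a)\<^sup>2 * 4 ^ a" by (intro mult_right_mono) auto
      then show ?thesis by (simp add: power_mult_distrib power4_eq power2_eq_square[of "2 ^ a"])
    qed
    ultimately show ?thesis using a by (simp add: field_simps)
  qed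
  also have "\<dots> \<le> 1 / 3"
    using exp_ge_add_one_self[of 2] by (simp add: exp_minus field_simps)
  finally show ?thesis by (simp add: Y_def h_def)
qed

section \<open>From the weighted vote to a randomized circuit\<close>

lemma sum_list_filter_distinct:
  assumes "distinct ks" "set ks = K"
  shows "(\<Sum>p\<leftarrow>filter Q ks. h p) = (\<Sum>p\<in>K. if Q p then h p else 0 :: 'b::comm_monoid_add)"
proof -
  have "(\<Sum>p\<leftarrow>filter Q ks. h p) = (\<Sum>p\<leftarrow>ks. if Q p then h p else 0)"
    by (simp add: sum_list_map_filter')
  then show ?thesis using assms by (simp add: sum_list_distinct_conv_sum_set)
qed

text \<open>The signed vote is positive iff the weight voting 1 exceeds half of the total weight
  \<open>W\<close>, which is a threshold test at \<open>W div 2 + 1\<close>. As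
  \<open>\<omega>\<close> is fixed, abstaining voters are dropped when the circuit is built and cost
  nothing.\<close>

lemma voting_circuit:
  assumes a: "a \<ge> 1" and \<omega>: "\<And>p. p \<in> voters a \<Longrightarrow> boolean_circuit n (\<omega> p)"
  shows "\<exists>E. boolean_circuit n E \<and> circuit_size E \<le> 55 * a\<^sup>2 * 4 ^ a \<and>
    (\<forall>x. circuit_output E x \<longleftrightarrow> (\<Sum>p\<in>voters a.
       if level (\<omega> p) = fst p then 2 ^ fst p * (if circuit_output (\<omega> p) x then 1 else - 1) else 0) > (0::real))"
proof -
  obtain ks where ks: "distinct ks" "set ks = voters a"
    using finite_distinct_list[OF finite_voters] by blast
  let ?Q = "\<lambda>p. level (\<omega> p) = fst p"
  define cs where "cs = map (\<lambda>p. (\<omega> p, 2 ^ fst p :: nat)) (filter ?Q ks)"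
  have card: "card (voters a) \<le> a * 4 ^ a"
  proof -
    have "card (voters a) = (\<Sum>l<a. 4 ^ (a - l))" using sum_voters[of "\<lambda>_. 1 :: nat" a] by simp
    also have "\<dots> \<le> (\<Sum>l<a. 4 ^ a)" by (intro sum_mono power_increasing) auto
    finally show ?thesis by simp
  qed
  define W where "W = (\<Sum>(D, w)\<leftarrow>cs. w)"
  have W_eq: "W = (\<Sum>p\<in>voters a. if ?Q p then 2 ^ fst p else 0)"
    unfolding W_def cs_def by (simp add: o_def sum_list_filter_distinct[OF ks])
  have W: "W < 2 ^ (3 * a)"
  proof -
    have "W \<le> (\<Sum>p\<in>voters a. 2 ^ fst p)" unfolding W_eq by (intro sum_mono) auto
    also have "\<dots> = (\<Sum>l<a. 4 ^ (a - l) * 2 ^ l)" using sum_voters[of "\<lambda>l. 2 ^ l :: nat" a] by simp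
    also have "\<dots> \<le> (\<Sum>l<a. 4 ^ (a - l) * 4 ^ l)" by (intro sum_mono mult_left_mono power_mono) auto
    also have "\<dots> = a * 4 ^ a" by (simp add: power4_split[where 'a = nat, symmetric])
    also have "\<dots> < 2 ^ a * 4 ^ a" by (intro mult_strict_right_mono) auto
    also have "\<dots> = 2 ^ (3 * a)" by (simp add: power4_eq flip: power_add)
    finally show ?thesis .
  qed
  have bc: "\<And>D w. (D, w) \<in> set cs \<Longrightarrow> boolean_circuit n D"
    using \<omega> ks by (auto simp: cs_def)
  have \<theta>: "W div 2 + 1 \<le> 2 ^ (3 * a)" using W by linarith
  obtain E where E: "boolean_circuit n E"
    "circuit_size E \<le> (\<Sum>(D, w)\<leftarrow>cs. circuit_size D) + length cs * (12 * Suc (3 * a)) + 3"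
    "\<And>x. circuit_output E x \<longleftrightarrow> W div 2 + 1 \<le> vote_sum cs x"
    using threshold_circuit[OF _ W[unfolded W_def] \<theta>, of n] bc by auto
  have "(\<Sum>(D, w)\<leftarrow>cs. circuit_size D) = (\<Sum>p\<in>voters a. if ?Q p then circuit_size (\<omega> p) else 0)"
    unfolding cs_def by (simp add: o_def sum_list_filter_distinct[OF ks])
  also have "\<dots> \<le> (\<Sum>p\<in>voters a. 4 ^ (fst p + 1))"
    by (intro sum_mono) (use level_bounds(2)[OF \<omega>] in \<open>fastforce intro: less_imp_le\<close>)
  also have "\<dots> = (\<Sum>l<a. 4 ^ (a - l) * 4 ^ (l + 1))" using sum_voters[of "\<lambda>l. 4 ^ (l + 1) :: nat" a] by simp
  also have "\<dots> = (\<Sum>l<a. 4 * 4 ^ a)" by (rule sum.cong) (auto simp: power4_split[where 'a = nat])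
  finally have size: "(\<Sum>(D, w)\<leftarrow>cs. circuit_size D) \<le> 4 * a * 4 ^ a" by simp
  have "length cs \<le> length ks" by (simp add: cs_def)
  also have "\<dots> = card (voters a)" using ks distinct_card by metis
  finally have "length cs * (12 * Suc (3 * a)) \<le> (a * 4 ^ a) * (12 * (4 * a))"
    using card a by (intro mult_mono) auto
  \<comment> \<open>The voters cost at most \<open>4 * z\<close>, the adders \<open>48 * z\<close>
    because \<open>Suc (3 * a) \<le> 4 * a\<close>, and the remaining three gates at most
    \<open>3 * z\<close>. This is the origin of 55.\<close>
  moreover define z where "z = a * a * 4 ^ a"
  moreover have "4 * a * 4 ^ a \<le> 4 * z" "1 \<le> z" using a by (simp_all add: z_def Suc_le_eq)
  moreover have "(a * 4 ^ a) * (12 * (4 * a)) = 48 * z" "55 * a\<^sup>2 * 4 ^ a = 55 * z"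
    by (simp_all add: z_def power2_eq_square)
  ultimately have sE: "circuit_size E \<le> 55 * a\<^sup>2 * 4 ^ a"
    using E(2) size by linarith
  have "circuit_output E x \<longleftrightarrow> (\<Sum>p\<in>voters a.
       if ?Q p then 2 ^ fst p * (if circuit_output (\<omega> p) x then 1 else - 1) else 0) > (0::real)" for x
  proof -
    have vs: "vote_sum cs x = (\<Sum>p\<in>voters a. if ?Q p then if circuit_output (\<omega> p) x then 2 ^ fst p else 0 else 0)"
      unfolding vote_sum_def cs_def by (simp add: o_def sum_list_filter_distinct[OF ks])
    have "circuit_output E x \<longleftrightarrow> 0 < 2 * real (vote_sum cs x) - real W"
      unfolding E(3) by linarith
    also have "2 * real (vote_sum cs x) - real W = (\<Sum>p\<in>voters a.
       if ?Q p then 2 ^ fst p * (if circuit_output (\<omega> p) x then 1 else - 1) else 0)"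
      unfolding vs W_eq of_nat_sum sum_distrib_left sum_subtractf[symmetric]
      by (rule sum.cong) auto
    finally show ?thesis .
  qed
  then show ?thesis using E(1) sE by blast
qed

text \<open>Draw all voters independently from \<open>q\<close> and output the circuit for their
  vote. The list \<open>[]\<close> is only the default value outside
  \<open>voters a\<close>.\<close>

lemma R_le_if_advantage:
  assumes a: "a \<ge> 1"
    and q: "finite (set_pmf q)" "\<And>C. C \<in> set_pmf q \<Longrightarrow> boolean_circuit n C"
    and adv: "\<And>x. x \<in> dom f \<Longrightarrow>
      4 * a / 2 ^ a \<le> measure_pmf.expectation q (\<lambda>C. agreement f C x / 2 ^ level C)"
  shows "R n f \<le> ennreal (55 * (real a)\<^sup>2 * 4 ^ a)"
proof -
  let ?P = "Pi_pmf (voters a) [] (\<lambda>_. q)"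
  define S where "S \<omega> x = (\<Sum>p\<in>voters a.
     if level (\<omega> p) = fst p then 2 ^ fst p * (if circuit_output (\<omega> p) x then 1 else - 1) else 0 :: real)"
    for \<omega> x
  have "\<exists>E. boolean_circuit n E \<and> circuit_size E \<le> 55 * a\<^sup>2 * 4 ^ a \<and>
      (\<forall>x. circuit_output E x \<longleftrightarrow> S \<omega> x > 0)" if "\<omega> \<in> set_pmf ?P" for \<omega>
    unfolding S_def
    by (rule voting_circuit[OF a]) (use that q(2) in \<open>auto simp: set_Pi_pmf PiE_dflt_def\<close>)
  then obtain G where G: "\<And>\<omega>. \<omega> \<in> set_pmf ?P \<Longrightarrow> boolean_circuit n (G \<omega>)"
    "\<And>\<omega>. \<omega> \<in> set_pmf ?P \<Longrightarrow> circuit_size (G \<omega>) \<le> 55 * a\<^sup>2 * 4 ^ a"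
    "\<And>\<omega> x. \<omega> \<in> set_pmf ?P \<Longrightarrow> circuit_output (G \<omega>) x \<longleftrightarrow> S \<omega> x > 0"
    by metis
  have err: "measure_pmf.prob (map_pmf G ?P) {C. f x \<noteq> Some (circuit_output C x)} \<le> 1 / 3"
    if x: "x \<in> dom f" for x
  proof -
    obtain b where b: "f x = Some b" using x by blast
    let ?S = "\<lambda>\<omega>. \<Sum>p\<in>voters a. if level (\<omega> p) = fst p then 2 ^ fst p * agreement f (\<omega> p) x else 0"
    have S: "?S \<omega> = (if b then S \<omega> x else - S \<omega> x)" for \<omega>
      unfolding S_def by (auto simp: agreement_def b sum_negf[symmetric] intro!: sum.cong)
    have "measure_pmf.prob (map_pmf G ?P) {C. f x \<noteq> Some (circuit_output C x)} =
        measure_pmf.prob ?P {\<omega>. f x \<noteq> Some (circuit_output (G \<omega>) x)}"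
      by (simp add: vimage_def)
    \<comment> \<open>Ties make the circuit output false; since \<open>voters_error\<close> counts a
      zero sum as an error, both values of \<open>b\<close> are covered.\<close>
    also have "\<dots> \<le> measure_pmf.prob ?P {\<omega>. ?S \<omega> \<le> 0}"
      by (rule measure_pmf.finite_measure_mono_AE)
        (auto intro!: AE_pmfI simp: b S G(3) split: if_splits)
    also have "\<dots> \<le> 1 / 3" by (rule voters_error[OF a q(1) adv[OF x]])
    finally show ?thesis .
  qed
  have "R n f \<le> ennreal (real (55 * a\<^sup>2 * 4 ^ a))"
    by (rule R_le[OF _ err]) (use G in \<open>auto simp: randomized_circuit_def\<close>)
  then show ?thesis by simp
qed

section \<open>The hard distribution\<close>

lemma normalize_weights:
  fixes w :: "'x \<Rightarrow> real"
  assumes X: "finite X" "X \<noteq> {}" and w: "\<And>x. x \<in> X \<Longrightarrow> w x > 0"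
  shows "\<exists>\<mu>. set_pmf \<mu> \<subseteq> X \<and> (\<forall>x\<in>X. pmf \<mu> x = w x / sum w X)"
proof -
  define g where "g x = (if x \<in> X then w x / sum w X else 0)" for x
  have pos: "sum w X > 0" using X w by (simp add: sum_pos)
  have nonneg: "0 \<le> g x" for x using w pos by (auto simp: g_def less_imp_le)
  have "(\<integral>\<^sup>+ x. ennreal (g x) \<partial>count_space UNIV) = (\<Sum>x\<in>X. ennreal (g x))"
    by (rule nn_integral_count_space'[OF X(1)]) (auto simp: g_def)
  also have "\<dots> = ennreal (\<Sum>x\<in>X. g x)" using nonneg by (simp add: sum_ennreal)
  also have "(\<Sum>x\<in>X. g x) = 1" using pos by (simp add: g_def flip: sum_divide_distrib)
  finally have "pmf (embed_pmf g) x = g x" for x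
    using nonneg by (intro pmf_embed_pmf) auto
  then show ?thesis
    by (intro exI[of _ "embed_pmf g"]) (auto simp: set_pmf_iff g_def split: if_splits)
qed

text \<open>If some circuit beats every \<open>\<mu>\<close>, then it answers every weight vector
  after normalization. \<open>approximate_minimax\<close> loses a factor 4, so its mixture has
  advantage \<open>4 * a / 2 ^ a\<close> on each input, as \<open>R_le_if_advantage\<close>
  requires, contradicting \<open>big\<close>.\<close>

lemma hard_distribution:
  assumes dom: "dom f \<subseteq> {x. length x = n}" "dom f \<noteq> {}"
    and a: "a \<ge> 1" and big: "\<not> R n f \<le> ennreal (55 * (real a)\<^sup>2 * 4 ^ a)"
  shows "\<exists>\<mu>. set_pmf \<mu> \<subseteq> dom f \<and> (\<forall>C. boolean_circuit n C \<longrightarrow>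
    (\<Sum>x\<in>dom f. pmf \<mu> x * agreement f C x) \<le> 16 * real a / 2 ^ a * 2 ^ level C)"
proof (rule ccontr)
  assume contra: "\<not> ?thesis"
  have fin: "finite (dom f)" by (rule finite_bool_lists[OF dom(1)])
  let ?M = "\<lambda>C x. agreement f C x / 2 ^ level C" and ?v = "16 * real a / 2 ^ a"
  have "\<exists>q. finite (set_pmf q) \<and> set_pmf q \<subseteq> {C. boolean_circuit n C} \<and>
    (\<forall>x\<in>dom f. ?v / 4 \<le> measure_pmf.expectation q (\<lambda>C. ?M C x))"
  proof (rule approximate_minimax[OF fin dom(2)])
    show "?v > 0" using a by simp
    show "\<bar>?M C x\<bar> \<le> 1" for C x by (simp add: abs_divide)
    fix w :: "bool list \<Rightarrow> real" assume w: "\<And>x. x \<in> dom f \<Longrightarrow> w x > 0"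
    obtain \<mu> where \<mu>: "set_pmf \<mu> \<subseteq> dom f" "\<And>x. x \<in> dom f \<Longrightarrow> pmf \<mu> x = w x / sum w (dom f)"
      using normalize_weights[OF fin dom(2), of w] w by auto
    have pos: "sum w (dom f) > 0" using fin dom w by (simp add: sum_pos)
    obtain C where C: "boolean_circuit n C"
      "?v * 2 ^ level C < (\<Sum>x\<in>dom f. pmf \<mu> x * agreement f C x)"
      using contra \<mu>(1) by (meson not_le)
    note C(2)
    also have "(\<Sum>x\<in>dom f. pmf \<mu> x * agreement f C x) = (\<Sum>x\<in>dom f. w x * agreement f C x) / sum w (dom f)"
      by (simp add: \<mu>(2) sum_divide_distrib)
    finally have "?v * 2 ^ level C * sum w (dom f) < (\<Sum>x\<in>dom f. w x * agreement f C x)"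
      using pos by (simp add: pos_less_divide_eq)
    then have "?v * sum w (dom f) \<le> (\<Sum>x\<in>dom f. w x * agreement f C x) / 2 ^ level C"
      by (simp add: pos_le_divide_eq mult_ac)
    then show "\<exists>C\<in>{C. boolean_circuit n C}. ?v * sum w (dom f) \<le> (\<Sum>x\<in>dom f. w x * ?M C x)"
      using C(1) by (auto simp: sum_divide_distrib)
  qed
  then obtain q where q: "finite (set_pmf q)" "set_pmf q \<subseteq> {C. boolean_circuit n C}"
    "\<And>x. x \<in> dom f \<Longrightarrow> ?v / 4 \<le> measure_pmf.expectation q (\<lambda>C. ?M C x)" by blast
  have "R n f \<le> ennreal (55 * (real a)\<^sup>2 * 4 ^ a)"
    by (rule R_le_if_advantage[OF a q(1)]) (use q(2,3) in auto)
  then show False using big by simp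
qed

text \<open>A single circuit with advantage \<open>\<gamma>\<close> has
  \<open>2 ^ level C \<ge> \<gamma> / v\<close>, hence size at least
  \<open>\<gamma>\<^sup>2 / v\<^sup>2\<close>. In a mixture the advantages differ, so a pointwise
  bound linear in error and size is averaged instead.\<close>

lemma R_dist_ge_if_small_agreement:
  assumes \<mu>: "set_pmf \<mu> \<subseteq> dom f" "finite (dom f)" and v: "v > 0" and \<gamma>: "0 < \<gamma>" "\<gamma> \<le> 1"
    and small: "\<And>C. boolean_circuit n C \<Longrightarrow>
      (\<Sum>x\<in>dom f. pmf \<mu> x * agreement f C x) \<le> v * 2 ^ level C"
  shows "ennreal (\<gamma>\<^sup>2 / v\<^sup>2) \<le> R_dist n \<mu> ((1 - \<gamma>) / 2) f"
  unfolding R_dist_def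
proof (rule Inf_greatest, safe)
  fix P assume P: "randomized_circuit n P"
    and err: "measure_pmf.prob (pair_pmf P \<mu>) {(C, x). f x \<noteq> Some (circuit_output C x)} \<le> (1 - \<gamma>) / 2"
  define e where "e C = measure_pmf.prob \<mu> {x. f x \<noteq> Some (circuit_output C x)}" for C
  have e: "(\<Sum>x\<in>dom f. pmf \<mu> x * agreement f C x) = 1 - 2 * e C" for C
  proof -
    let ?B = "{x \<in> dom f. f x \<noteq> Some (circuit_output C x)}"
    have "e C = measure_pmf.prob \<mu> ?B"
      unfolding e_def by (rule measure_pmf.finite_measure_eq_AE) (use \<mu> in \<open>auto intro!: AE_pmfI\<close>)
    also have "\<dots> = (\<Sum>x\<in>?B. pmf \<mu> x)" using \<mu> by (simp add: measure_measure_pmf_finite)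
    also have "\<dots> = (\<Sum>x\<in>dom f. if f x \<noteq> Some (circuit_output C x) then pmf \<mu> x else 0)"
      using \<mu>(2) by (intro sum.inter_filter)
    finally have "(\<Sum>x\<in>dom f. pmf \<mu> x) - 2 * e C = (\<Sum>x\<in>dom f. pmf \<mu> x * agreement f C x)"
      by (simp only: sum_distrib_left sum_subtractf[symmetric])
        (auto simp: agreement_def intro!: sum.cong)
    moreover have "(\<Sum>x\<in>dom f. pmf \<mu> x) = 1" using \<mu> by (simp add: sum_pmf_eq_1)
    ultimately show ?thesis by simp
  qed
  \<comment> \<open>By AM-GM, \<open>v * 2 ^ l \<le> \<gamma> / 2 + v\<^sup>2 * 4 ^ l / (2 * \<gamma>)\<close>, which is linear in the size.\<close>
  have pt: "1 \<le> 2 * e C + \<gamma> / 2 + v\<^sup>2 / (2 * \<gamma>) * circuit_size C" if "C \<in> set_pmf P" for C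
  proof -
    have C: "boolean_circuit n C" using P that by (simp add: randomized_circuit_def)
    let ?t = "2 ^ level C :: real"
    have "real (4 ^ level C) \<le> circuit_size C" using level_bounds(1)[OF C] by (rule of_nat_mono)
    then have t: "?t\<^sup>2 \<le> circuit_size C" by (simp add: power4_eq power2_eq_square)
    have "1 - 2 * e C \<le> v * ?t" using small[OF C] by (simp add: e)
    also have "\<dots> \<le> \<gamma> / 2 + v\<^sup>2 / (2 * \<gamma>) * ?t\<^sup>2"
    proof -
      have "0 \<le> (\<gamma> - v * ?t)\<^sup>2 / (2 * \<gamma>)" using \<gamma> by simp
      also have "\<dots> = \<gamma> / 2 + v\<^sup>2 / (2 * \<gamma>) * ?t\<^sup>2 - v * ?t"
        using \<gamma> by (simp add: field_simps power2_eq_square)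
      finally show ?thesis by simp
    qed
    also have "\<dots> \<le> \<gamma> / 2 + v\<^sup>2 / (2 * \<gamma>) * circuit_size C"
      using t \<gamma> by (intro add_left_mono mult_left_mono) auto
    finally show ?thesis by simp
  qed
  have "(\<integral>\<^sup>+ C. ennreal (e C) \<partial>P) =
      ennreal (measure_pmf.prob (pair_pmf P \<mu>) {(C, x). f x \<noteq> Some (circuit_output C x)})"
  proof -
    have "ennreal (measure_pmf.prob (pair_pmf P \<mu>) {(C, x). f x \<noteq> Some (circuit_output C x)}) =
      (\<integral>\<^sup>+ z. indicator {(C, x). f x \<noteq> Some (circuit_output C x)} z \<partial>pair_pmf P \<mu>)"
      by (simp add: measure_pmf.emeasure_eq_measure)
    also have "\<dots> = (\<integral>\<^sup>+ C. \<integral>\<^sup>+ x. indicator {x. f x \<noteq> Some (circuit_output C x)} x \<partial>\<mu> \<partial>P)"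
      unfolding nn_integral_pair_pmf' by (simp only: indicator_def mem_Collect_eq case_prod_conv)
    also have "\<dots> = (\<integral>\<^sup>+ C. ennreal (e C) \<partial>P)"
      by (simp add: e_def measure_pmf.emeasure_eq_measure)
    finally show ?thesis by simp
  qed
  also have "\<dots> \<le> ennreal ((1 - \<gamma>) / 2)" using err by (rule ennreal_leI)
  finally have E: "(\<integral>\<^sup>+ C. ennreal (e C) \<partial>P) \<le> ennreal ((1 - \<gamma>) / 2)" .
  show "ennreal (\<gamma>\<^sup>2 / v\<^sup>2) \<le> randomized_size P"
  proof (cases "randomized_size P = \<infinity>")
    case False
    then obtain s where s: "randomized_size P = ennreal s" "s \<ge> 0"
      by (metis ennreal_cases infinity_ennreal_def)
    have e0: "0 \<le> e C" for C by (simp add: e_def)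
    have lin: "ennreal 2 * ennreal p + ennreal g + ennreal k * ennreal t = ennreal (2 * p + g + k * t)"
      if "p \<ge> 0" "g \<ge> 0" "k \<ge> 0" "t \<ge> 0" for p g k t :: real
      using that by (simp add: ennreal_plus ennreal_mult del: ennreal_numeral)
    have "1 = (\<integral>\<^sup>+ C. 1 \<partial>P)" by simp
    also have "\<dots> \<le> (\<integral>\<^sup>+ C. ennreal 2 * ennreal (e C) + ennreal (\<gamma> / 2)
        + ennreal (v\<^sup>2 / (2 * \<gamma>)) * of_nat (circuit_size C) \<partial>P)"
    proof (intro nn_integral_mono_AE AE_pmfI)
      fix C assume C: "C \<in> set_pmf P"
      have "1 \<le> ennreal (2 * e C + \<gamma> / 2 + v\<^sup>2 / (2 * \<gamma>) * circuit_size C)"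
        using pt[OF C] by (metis ennreal_1 ennreal_leI)
      also have "\<dots> = ennreal 2 * ennreal (e C) + ennreal (\<gamma> / 2)
          + ennreal (v\<^sup>2 / (2 * \<gamma>)) * of_nat (circuit_size C)"
        unfolding ennreal_of_nat_eq_real_of_nat
        by (rule lin[symmetric]) (use e0 \<gamma> in auto)
      finally show "1 \<le> \<dots>" .
    qed
    also have "\<dots> = ennreal 2 * (\<integral>\<^sup>+ C. ennreal (e C) \<partial>P) + ennreal (\<gamma> / 2)
        + ennreal (v\<^sup>2 / (2 * \<gamma>)) * randomized_size P"
      by (simp add: nn_integral_add nn_integral_cmult randomized_size_def del: ennreal_numeral)
    also have "\<dots> \<le> ennreal 2 * ennreal ((1 - \<gamma>) / 2) + ennreal (\<gamma> / 2) + ennreal (v\<^sup>2 / (2 * \<gamma>)) * ennreal s"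
      unfolding s(1) by (intro add_mono mult_left_mono E) auto
    also have "\<dots> = ennreal (2 * ((1 - \<gamma>) / 2) + \<gamma> / 2 + v\<^sup>2 / (2 * \<gamma>) * s)"
      by (rule lin) (use \<gamma> s(2) in auto)
    finally have "1 \<le> 2 * ((1 - \<gamma>) / 2) + \<gamma> / 2 + v\<^sup>2 / (2 * \<gamma>) * s"
      by (metis ennreal_1 ennreal_le_iff2 not_one_le_zero zero_less_one not_le)
    \<comment> \<open>The error term contributes \<open>1 - \<gamma>\<close> and AM-GM another
      \<open>\<gamma> / 2\<close>; the remaining \<open>\<gamma> / 2\<close> must come from the
      size.\<close>
    then have "\<gamma> / 2 \<le> v\<^sup>2 * s / (2 * \<gamma>)" by (simp add: field_simps)
    then have "\<gamma>\<^sup>2 \<le> v\<^sup>2 * s" using \<gamma> by (simp add: field_simps power2_eq_square)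
    then have "\<gamma>\<^sup>2 / v\<^sup>2 \<le> s" using v by (simp add: field_simps)
    then show ?thesis unfolding s(1) by (rule ennreal_leI)
  qed simp
qed

text \<open>Every circuit has an output gate. This settles the case of small \<open>R n f\<close>,
  where the claimed bound is at most 1.\<close>

lemma R_dist_ge_1: "1 \<le> R_dist n \<mu> \<epsilon> f"
  unfolding R_dist_def
proof (rule Inf_greatest, safe)
  fix P assume P: "randomized_circuit n P"
  have "1 = (\<integral>\<^sup>+ C. 1 \<partial>measure_pmf P)" by simp
  also have "\<dots> \<le> randomized_size P"
    unfolding randomized_size_def
  proof (intro nn_integral_mono_AE AE_pmfI)
    fix C assume "C \<in> set_pmf P"
    then have "1 \<le> circuit_size C"
      using P by (auto simp: randomized_circuit_def boolean_circuit_def circuit_size_def Suc_le_eq)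
    then show "1 \<le> (of_nat (circuit_size C) :: ennreal)" by (metis of_nat_1 of_nat_mono)
  qed
  finally show "1 \<le> randomized_size P" .
qed

text \<open>Since \<open>enn2real\<close> maps infinity to 0, finiteness is what lets the logarithm
  in the theorem reflect \<open>R n f\<close>.\<close>

lemma R_finite:
  assumes "dom f \<subseteq> {x. length x = n}"
  shows "R n f < \<infinity>"
proof -
  obtain D where D: "boolean_circuit n D" "\<And>x. x \<in> dom f \<Longrightarrow> f x = Some (circuit_output D x)"
    using circuit_for_partial_function[OF assms] by blast
  have "R n f \<le> ennreal (circuit_size D)"
    by (rule R_le[of n "return_pmf D"]) (use D in \<open>auto simp: randomized_circuit_def\<close>)
  then show ?thesis using ennreal_less_top infinity_ennreal_def le_less_trans by metis
qed

text \<open>The summand 2 keeps the logarithm at least 1, and a distribution on \<open>dom f\<close>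
  can exist only if \<open>dom f\<close> is nonempty.\<close>

theorem theorem7p8:
  shows "\<exists>(c::real) (k::nat). c > 0 \<and>
    (\<forall>(n::nat) (f :: bool list \<rightharpoonup> bool).
       dom f \<subseteq> {x. length x = n} \<longrightarrow> dom f \<noteq> {} \<longrightarrow>
       (\<exists>\<mu> :: bool list pmf. set_pmf \<mu> \<subseteq> dom f \<and>
          (\<forall>\<gamma>::real. 0 < \<gamma> \<longrightarrow> \<gamma> \<le> 1 \<longrightarrow>
             R_dist n \<mu> ((1 - \<gamma>) / 2) f \<ge>
               ennreal (c * \<gamma>\<^sup>2) * R n f / ennreal (log 2 (2 + enn2real (R n f)) ^ k))))"
proof (rule exI[of _ "1 / 225280"], rule exI[of _ 4], intro conjI allI impI)
  fix n :: nat and f :: "bool list \<rightharpoonup> bool"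
  assume dom: "dom f \<subseteq> {x. length x = n}" "dom f \<noteq> {}"
  have fin: "finite (dom f)" by (rule finite_bool_lists[OF dom(1)])
  define r where "r = enn2real (R n f)"
  have r: "R n f = ennreal r" "r \<ge> 0" using R_finite[OF dom(1)] by (auto simp: r_def)
  let ?lg = "log 2 (2 + r)"
  have lg: "?lg \<ge> 1" using r(2) by simp
  have rhs: "ennreal (1 / 225280 * \<gamma>\<^sup>2) * R n f / ennreal (log 2 (2 + enn2real (R n f)) ^ 4) =
      ennreal (\<gamma>\<^sup>2 * r / (225280 * ?lg ^ 4))" for \<gamma> :: real
  proof -
    have "?lg ^ 4 > 0" using lg by (intro zero_less_power) linarith
    then show ?thesis
      using r(2) by (simp add: r_def[symmetric] r(1) divide_ennreal flip: ennreal_mult)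
  qed
  show "\<exists>\<mu>. set_pmf \<mu> \<subseteq> dom f \<and> (\<forall>\<gamma>>0. \<gamma> \<le> 1 \<longrightarrow>
      ennreal (1 / 225280 * \<gamma>\<^sup>2) * R n f / ennreal (log 2 (2 + enn2real (R n f)) ^ 4)
        \<le> R_dist n \<mu> ((1 - \<gamma>) / 2) f)"
  \<comment> \<open>220 is the bound \<open>55 * a\<^sup>2 * 4 ^ a\<close> at \<open>a = 1\<close>,
    so beyond it the choice of \<open>a\<close> below gives \<open>a \<ge> 1\<close>.\<close>
  proof (cases "r \<le> 220")
    case True
    obtain x where x: "x \<in> dom f" using dom by blast
    have "ennreal (\<gamma>\<^sup>2 * r / (225280 * ?lg ^ 4)) \<le> R_dist n (return_pmf x) ((1 - \<gamma>) / 2) f"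
      if \<gamma>: "0 < \<gamma>" "\<gamma> \<le> 1" for \<gamma>
    proof -
      have "\<gamma>\<^sup>2 * r \<le> 1 * 220" using \<gamma> True r(2) by (intro mult_mono) (auto simp: power_le_one)
      also have "\<dots> \<le> 225280 * ?lg ^ 4" using one_le_power[OF lg, of 4] by simp
      finally have "\<gamma>\<^sup>2 * r / (225280 * ?lg ^ 4) \<le> 1" using lg by (simp add: divide_le_eq_1)
      then have "ennreal (\<gamma>\<^sup>2 * r / (225280 * ?lg ^ 4)) \<le> 1" by (metis ennreal_1 ennreal_leI)
      also have "\<dots> \<le> R_dist n (return_pmf x) ((1 - \<gamma>) / 2) f" by (rule R_dist_ge_1)
      finally show ?thesis .
    qed
    then show ?thesis unfolding rhs using x by (intro exI[of _ "return_pmf x"]) auto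
  next
    case False
    let ?B = "\<lambda>b. 55 * (real b)\<^sup>2 * 4 ^ b"
    have "\<exists>b. r \<le> ?B (Suc b)"
    proof -
      obtain N :: nat where "r \<le> N" using real_arch_simple by blast
      also have "real N \<le> 1 * 4 ^ Suc N"
      proof -
        have "real N \<le> 2 ^ N" using less_exp[of N] by (simp add: less_imp_le)
        also have "\<dots> \<le> 4 ^ N" by (intro power_mono) auto
        also have "\<dots> \<le> 1 * 4 ^ Suc N" by simp
        finally show ?thesis .
      qed
      also have "1 * 4 ^ Suc N \<le> ?B (Suc N)"
      proof (intro mult_right_mono)
        have "1 \<le> (real (Suc N))\<^sup>2" by (rule one_le_power) simp
        then show "1 \<le> 55 * (real (Suc N))\<^sup>2" by linarith
      qed simp
      finally show ?thesis by blast
    qed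
    \<comment> \<open>With \<open>?B\<close> the bound on \<open>R n f\<close> obtained from
      \<open>a\<close> levels, this choice gives \<open>?B a < r \<le> ?B (Suc a)\<close>:
      \<open>a\<close> levels are too few, and \<open>r\<close> is still of order
      \<open>?B a\<close>.\<close>
    define a where "a = (LEAST b. r \<le> ?B (Suc b))"
    have up: "r \<le> ?B (Suc a)" unfolding a_def by (rule LeastI_ex) fact
    have a: "a \<ge> 1"
    proof (rule ccontr)
      assume "\<not> a \<ge> 1"
      then have "a = 0" by simp
      then show False using up False by simp
    qed
    then have "\<not> r \<le> ?B (Suc (a - 1))" unfolding a_def by (intro not_less_Least) auto
    then have low: "\<not> r \<le> ?B a" using a by simp
    then have "\<not> R n f \<le> ennreal (?B a)" unfolding r(1) by (subst ennreal_le_iff) auto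
    from hard_distribution[OF dom a this]
    obtain \<mu> where \<mu>: "set_pmf \<mu> \<subseteq> dom f" "\<And>C. boolean_circuit n C \<Longrightarrow>
      (\<Sum>x\<in>dom f. pmf \<mu> x * agreement f C x) \<le> 16 * real a / 2 ^ a * 2 ^ level C" by blast
    have a_lg: "a \<le> ?lg"
    proof -
      have "(2::real) ^ a \<le> 4 ^ a" by (intro power_mono) auto
      also have "\<dots> \<le> ?B a"
      proof -
        have "1 \<le> (real a)\<^sup>2" by (rule one_le_power) (use a in simp)
        then have "1 * 4 ^ a \<le> ?B a" by (intro mult_right_mono) auto
        then show ?thesis by simp
      qed
      also have "\<dots> \<le> 2 + r" using low by simp
      finally show ?thesis using r(2) by (simp add: le_log_iff powr_realpow)
    qed
    have "ennreal (\<gamma>\<^sup>2 * r / (225280 * ?lg ^ 4)) \<le> R_dist n \<mu> ((1 - \<gamma>) / 2) f"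
      if \<gamma>: "0 < \<gamma>" "\<gamma> \<le> 1" for \<gamma>
    proof -
      have "r \<le> ?B (Suc a)" by (rule up)
      \<comment> \<open>\<open>Suc a \<le> 2 * a\<close> because \<open>a \<ge> 1\<close>.\<close>
      also have "\<dots> \<le> 55 * (2 * real a)\<^sup>2 * 4 ^ Suc a"
        using a by (intro mult_right_mono mult_left_mono power_mono) auto
      also have "\<dots> = 880 * (real a)\<^sup>2 * 4 ^ a" by (simp add: power2_eq_square)
      finally have r_le: "r \<le> 880 * (real a)\<^sup>2 * 4 ^ a" .
      have "\<gamma>\<^sup>2 * r / (225280 * ?lg ^ 4) \<le> \<gamma>\<^sup>2 * (880 * (real a)\<^sup>2 * 4 ^ a) / (225280 * real a ^ 4)"
        using r_le a a_lg lg by (intro frac_le mult_left_mono power_mono) auto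
      \<comment> \<open>The constant is \<open>225280 = 880 * 16\<^sup>2\<close>. Of the four
        logarithmic factors, two come from \<open>a\<^sup>2\<close> in the bound on \<open>r\<close>
        and two from \<open>a\<^sup>2\<close> in the squared game value.\<close>
      also have "\<dots> = \<gamma>\<^sup>2 / (16 * real a / 2 ^ a)\<^sup>2"
        using a by (simp add: power4_eq field_simps eval_nat_numeral)
      finally have "ennreal (\<gamma>\<^sup>2 * r / (225280 * ?lg ^ 4)) \<le> ennreal (\<gamma>\<^sup>2 / (16 * real a / 2 ^ a)\<^sup>2)"
        by (rule ennreal_leI)
      also have "\<dots> \<le> R_dist n \<mu> ((1 - \<gamma>) / 2) f"
        by (rule R_dist_ge_if_small_agreement[OF \<mu>(1) fin _ \<gamma>]) (use a \<mu>(2) in auto)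
      finally show ?thesis .
    qed
    then show ?thesis unfolding rhs using \<mu>(1) by (intro exI[of _ \<mu>]) auto
  qed
qed simp

end
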